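(* Let $(V_i,v_i,\varphi^{(i)})_{i\in I}$ be a fusion frame system for $\mathcal{H}$, with $V=(V_i,v_i)_{i\in I}$, and let $v\varphi=(v_i\varphi_{ij})_{i\in I,j\in J_i}$ be the corresponding global frame. (1) If $\varphi^{(i)}$ is Parseval for every $i\in I$, then $S_{v\varphi}=S_V$. (2) If $\varphi^{(i)}$ is $A$-tight for every $i\in I$ (with the same $A$), then $S_{v\varphi}=A\cdot S_V$. (3) If $\varphi^{(i)}$ is $A_i$-tight for every $i\in I$, then $S_{v\varphi}=S_W$, where $W=(V_i,\sqrt{A_i}\,v_i)_{i\in I}$.
   Context: $\mathcal{H}$ is a separable Hilbert space; $\pi_U$ denotes the orthogonal projection onto a closed subspace $U$. A frame for a Hilbert space $K$ is a countable family $\psi=(\psi_j)_{j\in J}$ in $K$ with constants $0<A_\psi\le B_\psi<\infty$ (frame bounds) such that $A_\psi\|f\|^2\le\sum_j|\langle f,\psi_j\rangle|^2\le B_\psi\|f\|^2$ for all $f\in K$; it is $A_\psi$-tight if the frame bounds $A_\psi$ and $B_\psi$ can be chosen to be equal, and Parseval if it is $1$-tight. Its frame operator is $S_\psi f=\sum_j\langle f,\psi_j\rangle\psi_j$ on $K$. A fusion frame for $\mathcal{H}$ is a countable family $V=(V_i,v_i)_{i\in I}$ of closed subspaces with weights $v_i>0$ for which there are constants $0<A_V\le B_V<\infty$ with $A_V\|f\|^2\le\sum_{i} v_i^2\|\pi_{V_i}f\|^2\le B_V\|f\|^2$ for all $f\in\mathcal{H}$. For a weighted family of closed subspaces $V=(V_i,v_i)_{i\in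 I}$, the operator $S_V$ is $S_Vf=\sum_iv_i^2\pi_{V_i}f$ (on the set of $f$ for which the sum converges in $\mathcal{H}$; all of $\mathcal{H}$ for a fusion frame). A fusion frame system $(V_i,v_i,\varphi^{(i)})_{i\in I}$ for $\mathcal{H}$ consists of a fusion frame $V=(V_i,v_i)_{i\in I}$ for $\mathcal{H}$ and, for every $i\in I$, a frame $\varphi^{(i)}=(\varphi_{ij})_{j\in J_i}$ for $V_i$, such that these local frames have common frame bounds $0<A\le B<\infty$. Its global frame is $v\varphi=(v_i\varphi_{ij})_{i\in I,j\in J_i}$, which is a frame for $\mathcal{H}$. *)

theory Defs
  imports "HOL-Analysis.Analysis"
begin

text \<open>
  Hilbert spaces are treated uniformly over the real and the complex numbers. By the theorems of
  Gelfand-Mazur and Frobenius, a real normed field (whose norm is multiplicative) is isomorphic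
  to one of these two, and the axioms below then force the extra operation to be the usual
  conjugation; so this class describes exactly these two scalar fields.
\<close>

class rc_field = real_normed_field +
  fixes scalar_conj :: "'a \<Rightarrow> 'a"
  assumes scalar_conj_add: "scalar_conj (x + y) = scalar_conj x + scalar_conj y"
    and mult_scalar_conj: "x * scalar_conj x = (norm x)\<^sup>2 *\<^sub>R 1"

instantiation real :: rc_field
begin
definition scalar_conj_real :: "real \<Rightarrow> real" where "scalar_conj_real x = x"
instance
  by standard (simp_all add: scalar_conj_real_def power2_eq_square)
end

instantiation complex :: rc_field
begin
definition scalar_conj_complex :: "complex \<Rightarrow> complex" where "scalar_conj_complex = cnj"
instance
  by standard (simp_all add: scalar_conj_complex_def complex_norm_square scaleR_conv_of_real
    del: of_real_power)
end

text \<open>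
  A Hilbert space is the whole type \<open>'h\<close>; the norm and its completeness come from the class
  \<^class>\<open>banach\<close>, and the locale says that the norm is induced by the inner product \<open>ip\<close>
  (linear in the first argument).
\<close>

locale hilbert_space = vector_space smul
  for smul :: "'k::rc_field \<Rightarrow> 'h::banach \<Rightarrow> 'h" +
  fixes ip :: "'h \<Rightarrow> 'h \<Rightarrow> 'k"
  assumes smul_of_real: "smul (of_real r) x = r *\<^sub>R x"
    and ip_add_left: "ip (x + y) z = ip x z + ip y z"
    and ip_smul_left: "ip (smul c x) y = c * ip x y"
    and ip_conj: "ip y x = scalar_conj (ip x y)"
    and ip_self: "ip x x = of_real ((norm x)\<^sup>2)"

lemma hilbert_space_real:
  "hilbert_space (scaleR :: real \<Rightarrow> 'h \<Rightarrow> 'h::{real_inner,banach}) inner"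
  by unfold_locales
    (simp_all add: scaleR_add_right scaleR_add_left inner_add_left
      scalar_conj_real_def power2_norm_eq_inner, rule inner_commute)

lemma hilbert_space_complex:
  "hilbert_space ((*) :: complex \<Rightarrow> complex \<Rightarrow> complex) (\<lambda>x y. x * cnj y)"
  by unfold_locales
    (simp_all add: algebra_simps scalar_conj_complex_def complex_norm_square[symmetric]
      scaleR_conv_of_real flip: of_real_power)

definition closed_subspace :: "('k::rc_field \<Rightarrow> 'h::banach \<Rightarrow> 'h) \<Rightarrow> 'h set \<Rightarrow> bool" where
  "closed_subspace smul U \<longleftrightarrow> module.subspace smul U \<and> closed U"

definition orth_proj :: "('h::banach \<Rightarrow> 'h \<Rightarrow> 'k::rc_field) \<Rightarrow> 'h set \<Rightarrow> 'h \<Rightarrow> 'h" where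
  "orth_proj ip U f = (THE p. p \<in> U \<and> (\<forall>u\<in>U. ip (f - p) u = 0))"

text \<open>
  Sums over countable index sets, which carry no order, are unconditional sums. Since
  \<^const>\<open>infsum\<close> is 0 for families that are not summable, summability is always stated explicitly.
\<close>

definition frame_bounds ::
  "('h::banach \<Rightarrow> 'h \<Rightarrow> 'k::rc_field) \<Rightarrow> 'h set \<Rightarrow> 'j set \<Rightarrow> ('j \<Rightarrow> 'h) \<Rightarrow> real \<Rightarrow> real \<Rightarrow> bool" where
  "frame_bounds ip K J \<psi> A B \<longleftrightarrow>
     countable J \<and> \<psi> ` J \<subseteq> K \<and> 0 < A \<and> A \<le> B \<and>
     (\<forall>f\<in>K. (\<lambda>j. (norm (ip f (\<psi> j)))\<^sup>2) summable_on J \<and>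
        A * (norm f)\<^sup>2 \<le> (\<Sum>\<^sub>\<infinity>j\<in>J. (norm (ip f (\<psi> j)))\<^sup>2) \<and>
        (\<Sum>\<^sub>\<infinity>j\<in>J. (norm (ip f (\<psi> j)))\<^sup>2) \<le> B * (norm f)\<^sup>2)"

definition tight_frame ::
  "('h::banach \<Rightarrow> 'h \<Rightarrow> 'k::rc_field) \<Rightarrow> 'h set \<Rightarrow> 'j set \<Rightarrow> ('j \<Rightarrow> 'h) \<Rightarrow> real \<Rightarrow> bool" where
  "tight_frame ip K J \<psi> A \<longleftrightarrow> frame_bounds ip K J \<psi> A A"

definition parseval_frame ::
  "('h::banach \<Rightarrow> 'h \<Rightarrow> 'k::rc_field) \<Rightarrow> 'h set \<Rightarrow> 'j set \<Rightarrow> ('j \<Rightarrow> 'h) \<Rightarrow> bool" where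
  "parseval_frame ip K J \<psi> \<longleftrightarrow> tight_frame ip K J \<psi> 1"

definition fusion_frame ::
  "('k::rc_field \<Rightarrow> 'h::banach \<Rightarrow> 'h) \<Rightarrow> ('h \<Rightarrow> 'h \<Rightarrow> 'k) \<Rightarrow> 'i set \<Rightarrow> ('i \<Rightarrow> 'h set) \<Rightarrow> ('i \<Rightarrow> real) \<Rightarrow> bool"
  where
  "fusion_frame smul ip I V v \<longleftrightarrow>
     countable I \<and> (\<forall>i\<in>I. closed_subspace smul (V i) \<and> 0 < v i) \<and>
     (\<exists>A B. 0 < A \<and> A \<le> B \<and>
       (\<forall>f. (\<lambda>i. (v i)\<^sup>2 * (norm (orth_proj ip (V i) f))\<^sup>2) summable_on I \<and>
          A * (norm f)\<^sup>2 \<le> (\<Sum>\<^sub>\<infinity>i\<in>I. (v i)\<^sup>2 * (norm (orth_proj ip (V i) f))\<^sup>2) \<and>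
          (\<Sum>\<^sub>\<infinity>i\<in>I. (v i)\<^sup>2 * (norm (orth_proj ip (V i) f))\<^sup>2) \<le> B * (norm f)\<^sup>2))"

definition fusion_frame_system ::
  "('k::rc_field \<Rightarrow> 'h::banach \<Rightarrow> 'h) \<Rightarrow> ('h \<Rightarrow> 'h \<Rightarrow> 'k) \<Rightarrow>
   'i set \<Rightarrow> ('i \<Rightarrow> 'h set) \<Rightarrow> ('i \<Rightarrow> real) \<Rightarrow> ('i \<Rightarrow> 'j set) \<Rightarrow> ('i \<Rightarrow> 'j \<Rightarrow> 'h) \<Rightarrow> bool" where
  "fusion_frame_system smul ip I V v J \<phi> \<longleftrightarrow>
     fusion_frame smul ip I V v \<and>
     (\<exists>A B. 0 < A \<and> A \<le> B \<and> (\<forall>i\<in>I. frame_bounds ip (V i) (J i) (\<phi> i) A B))"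

text \<open>The global family is indexed by \<^term>\<open>Sigma I J\<close>.\<close>

definition global_frame :: "('i \<Rightarrow> real) \<Rightarrow> ('i \<Rightarrow> 'j \<Rightarrow> 'h::banach) \<Rightarrow> 'i \<times> 'j \<Rightarrow> 'h" where
  "global_frame v \<phi> = (\<lambda>(i, j). v i *\<^sub>R \<phi> i j)"

text \<open>
  The operators are partial maps, defined exactly where the sum converges, so that an equation
  between them includes the equality of their domains.
\<close>

definition frame_operator ::
  "('k::rc_field \<Rightarrow> 'h::banach \<Rightarrow> 'h) \<Rightarrow> ('h \<Rightarrow> 'h \<Rightarrow> 'k) \<Rightarrow> 'j set \<Rightarrow> ('j \<Rightarrow> 'h) \<Rightarrow> 'h \<rightharpoonup> 'h" where
  "frame_operator smul ip J \<psi> = (\<lambda>f.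
     if (\<lambda>j. smul (ip f (\<psi> j)) (\<psi> j)) summable_on J
     then Some (\<Sum>\<^sub>\<infinity>j\<in>J. smul (ip f (\<psi> j)) (\<psi> j)) else None)"

definition fusion_operator ::
  "('h::banach \<Rightarrow> 'h \<Rightarrow> 'k::rc_field) \<Rightarrow> 'i set \<Rightarrow> ('i \<Rightarrow> 'h set) \<Rightarrow> ('i \<Rightarrow> real) \<Rightarrow> 'h \<rightharpoonup> 'h" where
  "fusion_operator ip I V v = (\<lambda>f.
     if (\<lambda>i. (v i)\<^sup>2 *\<^sub>R orth_proj ip (V i) f) summable_on I
     then Some (\<Sum>\<^sub>\<infinity>i\<in>I. (v i)\<^sup>2 *\<^sub>R orth_proj ip (V i) f) else None)"

definition scale_operator :: "real \<Rightarrow> ('h::banach \<rightharpoonup> 'h) \<Rightarrow> 'h \<rightharpoonup> 'h" where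
  "scale_operator a T = (\<lambda>f. map_option (\<lambda>x. a *\<^sub>R x) (T f))"

end

theory Submission
  imports Defs
begin

text \<open>
  Write \<open>\<pi>\<^sub>i\<close> for the projection onto \<open>V\<^sub>i\<close>. Since \<open>\<phi>\<^sub>i\<^sub>j \<in> V\<^sub>i\<close>, the analysis coefficients of \<open>f\<close> are
  those of \<open>\<pi>\<^sub>i f\<close>; so the global family is Bessel and its frame series converge unconditionally.
  For an \<open>A\<close>-tight frame, the partial sums \<open>S\<^sub>F g\<close> of the frame operator satisfy
  \<open>\<parallel>S\<^sub>F g - A g\<parallel>\<^sup>2 \<le> A (A \<parallel>g\<parallel>\<^sup>2 - (\<Sum>j\<in>F. \<bar>\<langle>g, \<psi>\<^sub>j\<rangle>\<bar>\<^sup>2)) \<longrightarrow> 0\<close>, so that the local frame operators are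
  multiples of the identity without any polarization argument. Summing the global series first
  over \<open>j\<close> turns it into the fusion series with weights \<open>A\<^sub>i v\<^sub>i\<^sup>2\<close>.
\<close>

section \<open>Conjugation in the scalar field\<close>

lemma scalar_conj_0 [simp]: "scalar_conj 0 = (0 :: 'k::rc_field)"
  using scalar_conj_add[of 0 "0 :: 'k"] by simp

text \<open>Cancelling a nonzero \<open>x\<close> in \<open>mult_scalar_conj\<close> shows that the
  product formula determines the conjugate. Hence the class axioms also force conjugation to be
  multiplicative and to fix the reals.\<close>

lemma scalar_conj_eqI: "x * y = of_real ((norm x)\<^sup>2) \<Longrightarrow> x \<noteq> 0 \<Longrightarrow> scalar_conj x = (y :: 'k::rc_field)"
  using mult_scalar_conj[of x] by (metis mult_cancel_left of_real_def)

lemma mult_scalar_conj': "x * scalar_conj x = (of_real ((norm x)\<^sup>2) :: 'k::rc_field)"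
  by (simp only: mult_scalar_conj of_real_def)

lemma scalar_conj_of_real [simp]: "scalar_conj (of_real r) = (of_real r :: 'k::rc_field)"
proof (cases "r = 0")
  case False
  then show ?thesis
    by (intro scalar_conj_eqI) (simp_all add: power2_eq_square flip: of_real_mult)
qed simp

lemma scalar_conj_mult: "scalar_conj (x * y) = scalar_conj x * (scalar_conj y :: 'k::rc_field)"
proof (cases "x = 0 \<or> y = 0")
  case False
  have "(x * y) * (scalar_conj x * scalar_conj y) = (x * scalar_conj x) * (y * scalar_conj y)"
    by (simp only: mult_ac)
  also have "\<dots> = of_real ((norm (x * y))\<^sup>2)"
    by (simp only: mult_scalar_conj' norm_mult power_mult_distrib of_real_mult)
  finally show ?thesis
    using False by (intro scalar_conj_eqI) auto
qed auto

lemma norm_scalar_conj [simp]: "norm (scalar_conj x) = norm (x :: 'k::rc_field)"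
proof (cases "x = 0")
  case False
  have "norm x * norm (scalar_conj x) = norm x * norm x"
    using arg_cong[OF mult_scalar_conj'[of x], of norm]
    by (simp add: norm_mult power2_eq_square)
  with False show ?thesis by simp
qed simp

section \<open>Unconditional convergence from a summable bound on squared norms\<close>

lemma summable_on_norm_power2_le:
  fixes h :: "'j \<Rightarrow> 'h::banach"
  assumes g: "g summable_on J" "\<And>j. j \<in> J \<Longrightarrow> 0 \<le> g j"
    and h: "\<And>F. finite F \<Longrightarrow> F \<subseteq> J \<Longrightarrow> (norm (sum h F))\<^sup>2 \<le> B * sum g F"
    and B: "0 < B"
  shows "h summable_on J"
proof -
  \<comment> \<open>The net of finite partial sums is Cauchy: sums over supersets of a large
    \<open>F0\<close> differ from \<open>sum h F0\<close> by sums over sets disjoint from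
    \<open>F0\<close>, whose squared norms are controlled by the tail of \<open>g\<close>.\<close>
  have "\<exists>P. eventually P (finite_subsets_at_top J) \<and>
          (\<forall>F F'. P F \<and> P F' \<longrightarrow> dist (sum h F) (sum h F') < e)" if "0 < e" for e
  proof -
    \<comment> \<open>Chosen so that \<open>B * d\<close> is the square of \<open>e / 2\<close>, the
      distance allowed to \<open>sum h F0\<close>.\<close>
    define d where "d = (e / 2)\<^sup>2 / B"
    have "0 < d" using that B by (simp add: d_def)
    then obtain F0 where F0: "finite F0" "F0 \<subseteq> J" "norm (sum g F0 - infsum g J) < d"
      using has_sum_finite_approximation[OF has_sum_infsum[OF g(1)], of "d / 2"]
      by (force simp: dist_norm)
    define P where "P F \<longleftrightarrow> finite F \<and> F0 \<subseteq> F \<and> F \<subseteq> J" for F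
    have near: "dist (sum h F) (sum h F0) < e / 2" if "P F" for F
    proof -
      have F: "finite F" "F0 \<subseteq> F" "F \<subseteq> J" using that by (auto simp: P_def)
      have "(norm (sum h F - sum h F0))\<^sup>2 = (norm (sum h (F - F0)))\<^sup>2"
        using F by (simp add: sum_diff)
      also have "\<dots> \<le> B * sum g (F - F0)"
        using F by (intro h) auto
      also have "\<dots> = B * (sum g F - sum g F0)"
        using F by (simp add: sum_diff)
      also have "\<dots> \<le> B * (infsum g J - sum g F0)"
        using B F g by (intro mult_left_mono diff_right_mono finite_sum_le_infsum) auto
      also have "\<dots> < B * d"
        using B F0 by (intro mult_strict_left_mono) auto
      also have "\<dots> = (e / 2)\<^sup>2"
        using B by (simp add: d_def)
      finally show ?thesis
        using \<open>0 < e\<close> by (simp only: dist_norm) (rule power_less_imp_less_base, auto)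
    qed
    have "eventually P (finite_subsets_at_top J)"
      using F0 by (auto simp: eventually_finite_subsets_at_top P_def intro!: exI[of _ F0])
    moreover have "dist (sum h F) (sum h F') < e" if "P F" "P F'" for F F'
      using near that by (meson dist_triangle_half_l dist_commute)
    ultimately show ?thesis by blast
  qed
  then have "cauchy_filter (filtermap (sum h) (finite_subsets_at_top J))"
    by (simp add: cauchy_filter_metric_filtermap)
  then obtain L where "(sum h \<longlongrightarrow> L) (finite_subsets_at_top J)"
    using cauchy_filter_complete_converges[of _ UNIV] unfolding filterlim_def
    by (metis complete_UNIV filtermap_bot_iff finite_subsets_at_top_neq_bot top_greatest principal_UNIV UNIV_I)
  then show ?thesis
    by (auto simp: summable_on_def has_sum_def)
qed

context hilbert_space
begin

section \<open>Inner product identities\<close>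

lemma ip_add_right: "ip x (y + z) = ip x y + ip x z"
  using ip_conj[of x] by (metis ip_add_left scalar_conj_add)

lemma ip_smul_right: "ip x (smul c y) = scalar_conj c * ip x y"
  using ip_conj[of x] by (metis ip_smul_left scalar_conj_mult)

lemma ip_scaleR_left: "ip (r *\<^sub>R x) y = of_real r * ip x y"
  by (simp add: ip_smul_left flip: smul_of_real)

lemma ip_scaleR_right: "ip x (r *\<^sub>R y) = of_real r * ip x y"
  by (simp add: ip_smul_right flip: smul_of_real)

lemma ip_diff_left: "ip (x - y) z = ip x z - ip y z"
  using ip_add_left[of "x - y" y z] by simp

lemma ip_diff_right: "ip x (y - z) = ip x y - ip x z"
  using ip_add_right[of x "y - z" z] by simp

lemma ip_0_left [simp]: "ip 0 x = 0"
  using ip_diff_left[of 0 0 x] by simp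

lemma ip_sum_left: "ip (sum f F) x = (\<Sum>j\<in>F. ip (f j) x)"
  by (induction F rule: infinite_finite_induct) (simp_all add: ip_add_left)

lemma norm_ip_commute: "norm (ip x y) = norm (ip y x)"
  by (metis ip_conj norm_scalar_conj)

lemma ip_mult_ip: "ip x y * ip y x = of_real ((norm (ip x y))\<^sup>2)"
  using mult_scalar_conj'[of "ip x y"] by (simp flip: ip_conj)

text \<open>The class \<open>banach\<close> gives homogeneity of the norm for real scalars only; for
  \<open>smul\<close> it comes from the inner product.\<close>

lemma norm_smul: "norm (smul c x) = norm c * norm x"
proof -
  have "of_real ((norm (smul c x))\<^sup>2) = ip (smul c x) (smul c x)"
    by (simp only: ip_self)
  also have "\<dots> = (c * scalar_conj c) * ip x x"
    by (simp add: ip_smul_left ip_smul_right)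
  also have "\<dots> = of_real ((norm c * norm x)\<^sup>2)"
    by (simp only: mult_scalar_conj' ip_self power_mult_distrib of_real_mult)
  finally have "(norm (smul c x))\<^sup>2 = (norm c * norm x)\<^sup>2"
    by (simp only: of_real_eq_iff)
  then show ?thesis by simp
qed

text \<open>Kept in the scalar field so that the cross terms need no real part; injectivity of
  \<open>of_real\<close> leads back to the reals.\<close>

lemma of_real_norm_diff_power2:
  "(of_real ((norm (x - y))\<^sup>2) :: 'k) = of_real ((norm x)\<^sup>2) - ip x y - ip y x + of_real ((norm y)\<^sup>2)"
  by (simp only: ip_self[symmetric] ip_diff_left ip_diff_right) (simp add: algebra_simps)

lemma parallelogram:
  fixes x y :: 'h
  shows "(norm (x + y))\<^sup>2 + (norm (x - y))\<^sup>2 = 2 * (norm x)\<^sup>2 + 2 * (norm y)\<^sup>2"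
proof -
  have "ip (x + y) (x + y) + ip (x - y) (x - y) = 2 * ip x x + 2 * ip y y"
    by (simp add: ip_add_left ip_add_right ip_diff_left ip_diff_right)
  then have "(of_real ((norm (x + y))\<^sup>2 + (norm (x - y))\<^sup>2) :: 'k)
      = of_real (2 * (norm x)\<^sup>2 + 2 * (norm y)\<^sup>2)"
    by (simp only: ip_self of_real_add of_real_mult of_real_numeral)
  then show ?thesis by (simp only: of_real_eq_iff)
qed

section \<open>Existence and uniqueness of orthogonal projections\<close>

lemma subspace_scaleR: "subspace U \<Longrightarrow> x \<in> U \<Longrightarrow> r *\<^sub>R x \<in> U"
  by (metis smul_of_real subspace_scale)

text \<open>Moving \<open>p\<close> along the line of a nonzero \<open>u\<close> by the best
  coefficient lowers the squared distance by
  \<open>(norm (ip (f - p) u))\<^sup>2 / (norm u)\<^sup>2\<close>, which minimality forces to be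
  zero.\<close>

lemma minimizer_orthogonal:
  assumes U: "subspace U" and p: "p \<in> U" and min: "\<And>q. q \<in> U \<Longrightarrow> norm (f - p) \<le> norm (f - q)"
    and u: "u \<in> U"
  shows "ip (f - p) u = 0"
proof (cases "u = 0")
  case True
  then show ?thesis by (metis ip_0_left norm_eq_zero norm_ip_commute)
next
  case False
  define x where "x = f - p"
  define N where "N = (norm u)\<^sup>2"
  \<comment> \<open>With this \<open>c\<close>, \<open>smul c u\<close> is the projection of
    \<open>x\<close> onto the line spanned by \<open>u\<close>.\<close>
  define c where "c = ip x u / of_real N"
  have N: "0 < N" using False by (simp add: N_def)
  have c: "c * of_real N = ip x u" using N by (simp add: c_def)
  have "(of_real ((norm (x - smul c u))\<^sup>2) :: 'k)
      = of_real ((norm x)\<^sup>2) - scalar_conj c * ip x u - c * ip u x + c * scalar_conj c * of_real N"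
    by (simp only: of_real_norm_diff_power2)
      (simp add: ip_smul_left ip_smul_right norm_smul power_mult_distrib N_def mult_scalar_conj'
        flip: of_real_power)
  also have "\<dots> = of_real ((norm x)\<^sup>2) - ip x u * ip u x / of_real N"
    by (simp add: c[symmetric]) (simp add: c_def)
  also have "\<dots> = of_real ((norm x)\<^sup>2 - (norm (ip x u))\<^sup>2 / N)"
    by (simp only: ip_mult_ip of_real_diff of_real_divide)
  finally have "(norm (x - smul c u))\<^sup>2 = (norm x)\<^sup>2 - (norm (ip x u))\<^sup>2 / N"
    by (simp only: of_real_eq_iff)
  moreover have "norm x \<le> norm (x - smul c u)"
    using min[of "p + smul c u"] U p u
    by (simp add: x_def subspace_add subspace_scale diff_diff_eq)
  ultimately have "(norm (ip x u))\<^sup>2 / N \<le> 0"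
    using power_mono[of "norm x" "norm (x - smul c u)" 2] by simp
  then show ?thesis
    using N by (simp add: x_def divide_le_0_iff)
qed

text \<open>A minimizing sequence is Cauchy: midpoints stay in \<open>U\<close>, hence at distance
  at least \<open>d\<close> from \<open>f\<close>, and the parallelogram law turns this into a bound
  on the distance between members. Completeness and closedness supply the limit.\<close>

lemma minimizer_exists:
  assumes U: "subspace U" "closed U"
  obtains p where "p \<in> U" "\<And>q. q \<in> U \<Longrightarrow> norm (f - p) \<le> norm (f - q)"
proof -
  have ne: "U \<noteq> {}" using U subspace_0 by auto
  define d where "d = infdist f U"
  have d0: "0 \<le> d" by (simp add: d_def infdist_nonneg)
  have dle: "d \<le> norm (f - q)" if "q \<in> U" for q
    using infdist_le[OF that, of f] by (simp add: d_def dist_norm)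
  have "\<exists>p\<in>U. norm (f - p) < d + inverse (real (Suc n))" for n
  proof -
    have "infdist f U < d + inverse (real (Suc n))"
      by (simp add: d_def)
    then show ?thesis
      unfolding infdist_notempty[OF ne]
      by (subst (asm) cINF_less_iff) (use ne in \<open>auto simp: dist_norm intro!: bdd_belowI[of _ 0]\<close>)
  qed
  then obtain p where p: "\<And>n. p n \<in> U" "\<And>n. norm (f - p n) < d + inverse (real (Suc n))"
    by metis
  have lim: "(\<lambda>n. norm (f - p n)) \<longlonglongrightarrow> d"
  proof (rule tendsto_sandwich[where f = "\<lambda>_. d" and h = "\<lambda>n. d + inverse (real (Suc n))"])
    show "(\<lambda>n. d + inverse (real (Suc n))) \<longlonglongrightarrow> d"
      using tendsto_add[OF tendsto_const LIMSEQ_inverse_real_of_nat, of d] by simp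
  qed (use p dle in \<open>auto intro!: always_eventually less_imp_le simp del: of_nat_Suc\<close>)
  have pair: "(norm (p m - p n))\<^sup>2 \<le> 2 * (norm (f - p m))\<^sup>2 + 2 * (norm (f - p n))\<^sup>2 - 4 * d\<^sup>2" for m n
  proof -
    have "(1/2) *\<^sub>R (p m + p n) \<in> U"
      using U p by (intro subspace_scaleR subspace_add) auto
    from dle[OF this] have "2 * d \<le> norm (2 *\<^sub>R (f - (1/2) *\<^sub>R (p m + p n)))"
      by simp
    also have "2 *\<^sub>R (f - (1/2) *\<^sub>R (p m + p n)) = (f - p m) + (f - p n)"
      by (simp add: algebra_simps scaleR_2)
    finally have "(2 * d)\<^sup>2 \<le> (norm ((f - p m) + (f - p n)))\<^sup>2"
      using d0 by (intro power_mono) auto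
    with parallelogram[of "f - p m" "f - p n"] show ?thesis
      by (simp add: norm_minus_commute power_mult_distrib)
  qed
  have "Cauchy p"
  proof (rule metric_CauchyI)
    fix e :: real assume "0 < e"
    have "(\<lambda>n. (norm (f - p n))\<^sup>2) \<longlonglongrightarrow> d\<^sup>2"
      using lim by (rule tendsto_power)
    \<comment> \<open>The margin \<open>e\<^sup>2 / 4\<close> enters \<open>pair\<close> with total
      factor 4, while the terms in \<open>d\<^sup>2\<close> cancel; this leaves exactly
      \<open>e\<^sup>2\<close>.\<close>
    moreover have "d\<^sup>2 < d\<^sup>2 + e\<^sup>2 / 4" using \<open>0 < e\<close> by simp
    ultimately have "\<forall>\<^sub>F n in sequentially. (norm (f - p n))\<^sup>2 < d\<^sup>2 + e\<^sup>2 / 4"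
      by (rule order_tendstoD)
    then obtain M where M: "\<And>n. M \<le> n \<Longrightarrow> (norm (f - p n))\<^sup>2 < d\<^sup>2 + e\<^sup>2 / 4"
      by (auto simp: eventually_sequentially)
    have "dist (p m) (p n) < e" if "M \<le> m" "M \<le> n" for m n
    proof -
      have "(norm (p m - p n))\<^sup>2 < e\<^sup>2"
        using pair[of m n] M[OF that(1)] M[OF that(2)] by simp
      then show ?thesis
        using \<open>0 < e\<close> by (auto simp: dist_norm intro: power_less_imp_less_base)
    qed
    then show "\<exists>M. \<forall>m\<ge>M. \<forall>n\<ge>M. dist (p m) (p n) < e" by blast
  qed
  then obtain l where l: "p \<longlonglongrightarrow> l"
    using convergent_eq_Cauchy by blast
  have "(\<lambda>n. norm (f - p n)) \<longlonglongrightarrow> norm (f - l)"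
    using l by (intro tendsto_intros)
  with lim have "norm (f - l) = d" by (rule LIMSEQ_unique[symmetric])
  moreover have "l \<in> U"
    using U(2) p(1) l by (rule closed_sequentially)
  ultimately show thesis using dle that by metis
qed

text \<open>The \<open>THE\<close> in the definition is meaningful: a minimizer satisfies the
  orthogonality condition, and the difference of two solutions is orthogonal to itself. The second
  claim lets coefficients of \<open>f\<close> against vectors of \<open>U\<close> be computed from
  its projection.\<close>

lemma orth_proj:
  assumes "closed_subspace smul U"
  shows orth_proj_in: "orth_proj ip U f \<in> U"
    and ip_orth_proj: "u \<in> U \<Longrightarrow> ip (orth_proj ip U f) u = ip f u"
proof -
  have U: "subspace U" "closed U"
    using assms by (auto simp: closed_subspace_def)
  obtain p where p: "p \<in> U" "\<And>q. q \<in> U \<Longrightarrow> norm (f - p) \<le> norm (f - q)"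
    using minimizer_exists[OF U] by metis
  have "\<exists>!p. p \<in> U \<and> (\<forall>u\<in>U. ip (f - p) u = 0)"
  proof (rule ex1I)
    show "p \<in> U \<and> (\<forall>u\<in>U. ip (f - p) u = 0)"
      using minimizer_orthogonal[OF U(1) p] p(1) by blast
    fix q assume q: "q \<in> U \<and> (\<forall>u\<in>U. ip (f - q) u = 0)"
    have "q - p \<in> U" using U p q by (simp add: subspace_diff)
    then have "ip (f - p) (q - p) - ip (f - q) (q - p) = 0"
      using minimizer_orthogonal[OF U(1) p] q by simp
    then have "ip (q - p) (q - p) = 0"
      by (simp flip: ip_diff_left)
    then show "q = p" by (simp add: ip_self)
  qed
  from theI'[OF this]
  show "orth_proj ip U f \<in> U" "u \<in> U \<Longrightarrow> ip (orth_proj ip U f) u = ip f u"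
    unfolding orth_proj_def[symmetric] by (auto simp: ip_diff_left)
qed

section \<open>Bounds for synthesis and reconstruction by tight frames\<close>

lemma synthesis_bound:
  assumes K: "subspace K" and \<psi>: "\<psi> ` F \<subseteq> K" "finite F"
    and bessel: "\<And>x. x \<in> K \<Longrightarrow> (\<Sum>j\<in>F. (norm (ip x (\<psi> j)))\<^sup>2) \<le> B * (norm x)\<^sup>2"
    and B: "0 \<le> B"
  shows "(norm (\<Sum>j\<in>F. smul (c j) (\<psi> j)))\<^sup>2 \<le> B * (\<Sum>j\<in>F. (norm (c j))\<^sup>2)"
proof -
  define x where "x = (\<Sum>j\<in>F. smul (c j) (\<psi> j))"
  define C where "C = (\<Sum>j\<in>F. (norm (c j))\<^sup>2)"
  have C: "0 \<le> C" by (simp add: C_def sum_nonneg)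
  have x: "x \<in> K"
    unfolding x_def using K \<psi> by (intro subspace_sum subspace_scale) auto
  \<comment> \<open>Duality: Cauchy-Schwarz for the expanded \<open>ip x x\<close>, with the Bessel
    bound at \<open>x\<close> itself, gives
    \<open>(norm x)\<^sup>2 \<le> sqrt (B * C) * norm x\<close>, and one factor cancels.\<close>
  have "(norm x)\<^sup>2 = norm (ip x x)"
    by (simp add: ip_self norm_power)
  also have "ip x x = (\<Sum>j\<in>F. c j * ip (\<psi> j) x)"
    by (subst (1) x_def) (simp add: ip_sum_left ip_smul_left)
  also have "norm \<dots> \<le> (\<Sum>j\<in>F. \<bar>norm (c j)\<bar> * \<bar>norm (ip x (\<psi> j))\<bar>)"
    by (rule sum_norm_le) (simp add: norm_mult norm_ip_commute)
  also have "\<dots> \<le> L2_set (\<lambda>j. norm (c j)) F * L2_set (\<lambda>j. norm (ip x (\<psi> j))) F"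
    by (rule L2_set_mult_ineq)
  also have "\<dots> \<le> sqrt C * sqrt (B * (norm x)\<^sup>2)"
    unfolding L2_set_def C_def[symmetric] using C bessel[OF x]
    by (intro mult_left_mono real_sqrt_le_mono) auto
  also have "\<dots> = sqrt (B * C) * norm x"
    by (simp add: real_sqrt_mult)
  finally have "norm x * norm x \<le> sqrt (B * C) * norm x"
    by (simp add: power2_eq_square)
  then have "norm x \<le> sqrt (B * C)"
    using B C by (cases "x = 0") auto
  then have "(norm x)\<^sup>2 \<le> (sqrt (B * C))\<^sup>2"
    by (intro power_mono) auto
  then show ?thesis
    using B C by (simp add: x_def C_def)
qed

lemma tight_frame_has_sum:
  assumes K: "subspace K" and tight: "tight_frame ip K J \<psi> A" and g: "g \<in> K"
  shows "((\<lambda>j. smul (ip g (\<psi> j)) (\<psi> j)) has_sum A *\<^sub>R g) J"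
proof -
  have A: "0 < A" and \<psi>: "\<psi> ` J \<subseteq> K"
    and summable: "\<And>x. x \<in> K \<Longrightarrow> (\<lambda>j. (norm (ip x (\<psi> j)))\<^sup>2) summable_on J"
    and total: "\<And>x. x \<in> K \<Longrightarrow> (\<Sum>\<^sub>\<infinity>j\<in>J. (norm (ip x (\<psi> j)))\<^sup>2) = A * (norm x)\<^sup>2"
    using tight by (auto simp: tight_frame_def frame_bounds_def intro: antisym)
  define s where "s F = (\<Sum>j\<in>F. (norm (ip g (\<psi> j)))\<^sup>2)" for F
  define S where "S F = (\<Sum>j\<in>F. smul (ip g (\<psi> j)) (\<psi> j))" for F
  have bound: "(norm (S F - A *\<^sub>R g))\<^sup>2 \<le> A * (A * (norm g)\<^sup>2 - s F)" if F: "finite F" "F \<subseteq> J" for F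
  proof -
    have "(norm (S F))\<^sup>2 \<le> A * s F"
      unfolding S_def s_def
    proof (rule synthesis_bound[OF K])
      show "(\<Sum>j\<in>F. (norm (ip x (\<psi> j)))\<^sup>2) \<le> A * (norm x)\<^sup>2" if "x \<in> K" for x
        unfolding total[OF that, symmetric] using F summable[OF that]
        by (intro finite_sum_le_infsum) auto
    qed (use A F \<psi> in auto)
    moreover have Sg: "ip (S F) g = of_real (s F)"
      by (simp add: S_def s_def ip_sum_left ip_smul_left ip_mult_ip del: of_real_power)
    \<comment> \<open>Both cross terms equal \<open>A * s F\<close>, because
      \<open>ip (S F) g\<close> is real. The synthesis bound on \<open>S F\<close> absorbs one of
      them; the other survives in \<open>bound\<close>.\<close>
    have "(of_real ((norm (S F - A *\<^sub>R g))\<^sup>2) :: 'k)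
        = of_real ((norm (S F))\<^sup>2 - A * s F - A * s F + (A * norm g)\<^sup>2)"
      using A unfolding of_real_norm_diff_power2
      by (simp add: ip_scaleR_left ip_scaleR_right Sg ip_conj[of g])
    then have "(norm (S F - A *\<^sub>R g))\<^sup>2 = (norm (S F))\<^sup>2 - A * s F - A * s F + (A * norm g)\<^sup>2"
      by (simp only: of_real_eq_iff)
    ultimately show ?thesis
      by (simp add: algebra_simps power2_eq_square)
  qed
  \<comment> \<open>Tightness identifies the limit of \<open>s\<close> exactly, so the right side of
    \<open>bound\<close> tends to zero.\<close>
  have "(s \<longlongrightarrow> A * (norm g)\<^sup>2) (finite_subsets_at_top J)"
    using has_sum_infsum[OF summable[OF g]] by (simp add: total[OF g] has_sum_def s_def[abs_def])
  then have "((\<lambda>F. sqrt (A * (A * (norm g)\<^sup>2 - s F))) \<longlongrightarrow> sqrt (A * (A * (norm g)\<^sup>2 - A * (norm g)\<^sup>2)))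
      (finite_subsets_at_top J)"
    by (intro tendsto_intros)
  then have "((\<lambda>F. sqrt (A * (A * (norm g)\<^sup>2 - s F))) \<longlongrightarrow> 0) (finite_subsets_at_top J)"
    by simp
  moreover have "\<forall>\<^sub>F F in finite_subsets_at_top J. norm (S F - A *\<^sub>R g) \<le> sqrt (A * (A * (norm g)\<^sup>2 - s F))"
    by (intro eventually_finite_subsets_at_top_weakI real_le_rsqrt bound)
  ultimately have "((\<lambda>F. S F - A *\<^sub>R g) \<longlongrightarrow> 0) (finite_subsets_at_top J)"
    by (rule Lim_null_comparison[rotated])
  then show ?thesis
    by (simp add: has_sum_def S_def[abs_def] LIM_zero_iff)
qed

section \<open>The global family of a fusion frame system\<close>

lemma global_frame_bessel:
  assumes "fusion_frame_system smul ip I V v J \<phi>"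
  obtains C where "0 < C"
    "\<And>f. (\<lambda>k. (norm (ip f (global_frame v \<phi> k)))\<^sup>2) summable_on Sigma I J"
    "\<And>f. (\<Sum>\<^sub>\<infinity>k\<in>Sigma I J. (norm (ip f (global_frame v \<phi> k)))\<^sup>2) \<le> C * (norm f)\<^sup>2"
proof -
  obtain A B where B: "0 < A" "A \<le> B"
    and local: "\<And>i. i \<in> I \<Longrightarrow> frame_bounds ip (V i) (J i) (\<phi> i) A B"
    and fusion: "fusion_frame smul ip I V v"
    using assms by (auto simp: fusion_frame_system_def)
  obtain A' D where D: "0 < A'" "A' \<le> D"
    and V: "\<And>i. i \<in> I \<Longrightarrow> closed_subspace smul (V i)"
    and sumV: "\<And>f. (\<lambda>i. (v i)\<^sup>2 * (norm (orth_proj ip (V i) f))\<^sup>2) summable_on I"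
    and leV: "\<And>f. (\<Sum>\<^sub>\<infinity>i\<in>I. (v i)\<^sup>2 * (norm (orth_proj ip (V i) f))\<^sup>2) \<le> D * (norm f)\<^sup>2"
    using fusion by (auto simp: fusion_frame_def)
  have *: "(\<lambda>k. (norm (ip f (global_frame v \<phi> k)))\<^sup>2) summable_on Sigma I J \<and>
    (\<Sum>\<^sub>\<infinity>k\<in>Sigma I J. (norm (ip f (global_frame v \<phi> k)))\<^sup>2) \<le> B * D * (norm f)\<^sup>2" for f
  proof -
    let ?t = "\<lambda>k. (norm (ip f (global_frame v \<phi> k)))\<^sup>2"
    let ?p = "\<lambda>i. orth_proj ip (V i) f"
    \<comment> \<open>The contribution of the fibre over \<open>i\<close>, written with the
      projection because the local frame bounds speak only of vectors in \<open>V i\<close>.\<close>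
    define G where "G i = (v i)\<^sup>2 * (\<Sum>\<^sub>\<infinity>j\<in>J i. (norm (ip (?p i) (\<phi> i j)))\<^sup>2)" for i
    have p: "?p i \<in> V i" if "i \<in> I" for i
      by (rule orth_proj_in[OF V[OF that]])
    have inner: "((\<lambda>j. ?t (i, j)) has_sum G i) (J i)" if i: "i \<in> I" for i
    proof -
      have "((\<lambda>j. (v i)\<^sup>2 * (norm (ip (?p i) (\<phi> i j)))\<^sup>2) has_sum G i) (J i)"
        unfolding G_def using local[OF i] p[OF i]
        by (intro has_sum_cmult_right has_sum_infsum) (auto simp: frame_bounds_def)
      moreover have "?t (i, j) = (v i)\<^sup>2 * (norm (ip (?p i) (\<phi> i j)))\<^sup>2" if "j \<in> J i" for j
      proof -
        have "\<phi> i j \<in> V i" using local[OF i] that by (auto simp: frame_bounds_def)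
        then show ?thesis
          by (simp add: global_frame_def ip_scaleR_right norm_mult power_mult_distrib
              ip_orth_proj[OF V[OF i]])
      qed
      ultimately show ?thesis by (simp cong: has_sum_cong)
    qed
    have G_le: "G i \<le> B * ((v i)\<^sup>2 * (norm (?p i))\<^sup>2)" if "i \<in> I" for i
    proof -
      have "(v i)\<^sup>2 * (\<Sum>\<^sub>\<infinity>j\<in>J i. (norm (ip (?p i) (\<phi> i j)))\<^sup>2) \<le> (v i)\<^sup>2 * (B * (norm (?p i))\<^sup>2)"
        using local[OF that] p[OF that] by (intro mult_left_mono) (auto simp: frame_bounds_def)
      then show ?thesis by (simp add: G_def mult_ac)
    qed
    have G_ge: "0 \<le> G i" for i
      by (simp add: G_def infsum_nonneg)
    have sumBV: "(\<lambda>i. B * ((v i)\<^sup>2 * (norm (?p i))\<^sup>2)) summable_on I"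
      by (intro summable_on_cmult_right sumV)
    have sumG: "G summable_on I"
      using sumBV G_le G_ge by (rule summable_on_comparison_test)
    \<comment> \<open>The terms are nonnegative, so summability of the fibre sums already gives that
      of the double series.\<close>
    have sumt: "?t summable_on Sigma I J"
      using inner sumG by (rule summable_on_SigmaI) auto
    have "(G has_sum infsum ?t (Sigma I J)) I"
      using has_sum_infsum[OF sumt] inner by (rule has_sum_SigmaD)
    then have "infsum ?t (Sigma I J) = infsum G I"
      by (simp add: infsumI)
    also have "\<dots> \<le> (\<Sum>\<^sub>\<infinity>i\<in>I. B * ((v i)\<^sup>2 * (norm (?p i))\<^sup>2))"
      using sumG sumBV G_le by (rule infsum_mono)
    also have "\<dots> = B * (\<Sum>\<^sub>\<infinity>i\<in>I. (v i)\<^sup>2 * (norm (?p i))\<^sup>2)"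
      by (rule infsum_cmult_right) (use sumV in auto)
    also have "\<dots> \<le> B * (D * (norm f)\<^sup>2)"
      using B leV by (intro mult_left_mono) auto
    finally show ?thesis using sumt by (simp add: mult_ac)
  qed
  \<comment> \<open>The local upper bound times the fusion upper bound.\<close>
  show thesis by (rule that[of "B * D"]) (use * B D in auto)
qed

text \<open>The Bessel property and \<open>synthesis_bound\<close> on the whole space control finite
  partial sums by the summable squared coefficients, so the Cauchy criterion applies; absolute
  convergence is never claimed.\<close>

lemma global_frame_operator_summable:
  assumes "fusion_frame_system smul ip I V v J \<phi>"
  shows "(\<lambda>k. smul (ip f (global_frame v \<phi> k)) (global_frame v \<phi> k)) summable_on Sigma I J"
proof -
  obtain C where C: "0 < C"
    and sum: "\<And>f. (\<lambda>k. (norm (ip f (global_frame v \<phi> k)))\<^sup>2) summable_on Sigma I J"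
    and le: "\<And>f. (\<Sum>\<^sub>\<infinity>k\<in>Sigma I J. (norm (ip f (global_frame v \<phi> k)))\<^sup>2) \<le> C * (norm f)\<^sup>2"
    using global_frame_bessel[OF assms] by metis
  show ?thesis
  proof (rule summable_on_norm_power2_le[OF sum _ _ C])
    fix F assume F: "finite F" "F \<subseteq> Sigma I J"
    show "(norm (\<Sum>k\<in>F. smul (ip f (global_frame v \<phi> k)) (global_frame v \<phi> k)))\<^sup>2
        \<le> C * (\<Sum>k\<in>F. (norm (ip f (global_frame v \<phi> k)))\<^sup>2)"
    proof (rule synthesis_bound[OF subspace_UNIV])
      show "(\<Sum>k\<in>F. (norm (ip x (global_frame v \<phi> k)))\<^sup>2) \<le> C * (norm x)\<^sup>2" for x
        using finite_sum_le_infsum[OF sum[of x] F] le[of x] by simp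
    qed (use F C in auto)
  qed auto
qed

text \<open>The series over \<open>Sigma I J\<close> is summed fibre by fibre; on each fibre the
  local frame operator acts on the projection of \<open>f\<close> as multiplication by
  \<open>A i\<close>.\<close>

lemma global_frame_operator_tight:
  assumes sys: "fusion_frame_system smul ip I V v J \<phi>"
    and tight: "\<And>i. i \<in> I \<Longrightarrow> tight_frame ip (V i) (J i) (\<phi> i) (A i)"
  shows "frame_operator smul ip (Sigma I J) (global_frame v \<phi>)
       = fusion_operator ip I V (\<lambda>i. sqrt (A i) * v i)"
proof
  fix f
  let ?t = "\<lambda>k. smul (ip f (global_frame v \<phi> k)) (global_frame v \<phi> k)"
  let ?u = "\<lambda>i. (sqrt (A i) * v i)\<^sup>2 *\<^sub>R orth_proj ip (V i) f"
  have inner: "((\<lambda>j. ?t (i, j)) has_sum ?u i) (J i)" if i: "i \<in> I" for i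
  proof -
    have V: "closed_subspace smul (V i)"
      using sys i by (auto simp: fusion_frame_system_def fusion_frame_def)
    have A: "0 < A i" and \<phi>: "\<phi> i ` J i \<subseteq> V i"
      using tight[OF i] by (auto simp: tight_frame_def frame_bounds_def)
    let ?p = "orth_proj ip (V i) f"
    have "((\<lambda>j. smul (ip ?p (\<phi> i j)) (\<phi> i j)) has_sum A i *\<^sub>R ?p) (J i)"
      using V by (intro tight_frame_has_sum[OF _ tight[OF i]] orth_proj_in)
        (auto simp: closed_subspace_def)
    from has_sum_scaleR[OF this, of "(v i)\<^sup>2"]
    have "((\<lambda>j. (v i)\<^sup>2 *\<^sub>R smul (ip ?p (\<phi> i j)) (\<phi> i j)) has_sum ?u i) (J i)"
      using A by (simp add: power_mult_distrib mult.commute)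
    \<comment> \<open>One factor \<open>v i\<close> comes from the coefficient, the other from the
      vector.\<close>
    moreover have "?t (i, j) = (v i)\<^sup>2 *\<^sub>R smul (ip ?p (\<phi> i j)) (\<phi> i j)" if "j \<in> J i" for j
      using \<phi> that
      by (simp add: global_frame_def ip_smul_right ip_orth_proj[OF V] image_subset_iff
          power2_eq_square mult_ac flip: smul_of_real)
    ultimately show ?thesis by (simp cong: has_sum_cong)
  qed
  have t: "?t summable_on Sigma I J"
    by (rule global_frame_operator_summable[OF sys])
  \<comment> \<open>Convergence of the double series passes to the outer series, so the fusion
    operator is defined at \<open>f\<close> as well.\<close>
  have "(?u has_sum infsum ?t (Sigma I J)) I"
    using has_sum_infsum[OF t] inner by (rule has_sum_SigmaD)
  then have "?u summable_on I" "infsum ?u I = infsum ?t (Sigma I J)"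
    by (auto simp: summable_on_def infsumI)
  with t show "frame_operator smul ip (Sigma I J) (global_frame v \<phi>) f
       = fusion_operator ip I V (\<lambda>i. sqrt (A i) * v i) f"
    by (simp add: frame_operator_def fusion_operator_def)
qed

end

section \<open>Constant tightness bounds and conclusion\<close>

lemma fusion_operator_sqrt_const:
  fixes ip :: "'h::banach \<Rightarrow> 'h \<Rightarrow> 'k::rc_field" and I :: "'i set"
  assumes "I \<noteq> {} \<Longrightarrow> 0 < A"
  shows "fusion_operator ip I V (\<lambda>i. sqrt A * v i) = scale_operator A (fusion_operator ip I V v)"
proof (cases "I = {}")
  \<comment> \<open>Without indices, tightness says nothing about the sign of \<open>A\<close>; both
    sides are then \<open>Some 0\<close> everywhere.\<close>
  case True
  then show ?thesis by (simp add: fun_eq_iff fusion_operator_def scale_operator_def)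
next
  case False
  with assms have A: "0 < A" by blast
  then have "(sqrt A * v i)\<^sup>2 = A * (v i)\<^sup>2" for i
    by (simp add: power_mult_distrib)
  \<comment> \<open>Scaling by \<open>A\<close> is invertible, so both partial maps have the same
    domain.\<close>
  moreover have "(\<lambda>i. A *\<^sub>R g i) summable_on I \<longleftrightarrow> g summable_on I" for g :: "'i \<Rightarrow> 'h"
    using A summable_on_scaleR_right[of A g I]
      summable_on_scaleR_right[of "inverse A" "\<lambda>i. A *\<^sub>R g i" I]
    by auto
  ultimately show ?thesis
    by (simp add: fun_eq_iff fusion_operator_def scale_operator_def infsum_scaleR_right
        flip: scaleR_scaleR)
qed

theorem corollary4p10:
  fixes smul :: "'k::rc_field \<Rightarrow> 'h::banach \<Rightarrow> 'h"
    and ip :: "'h \<Rightarrow> 'h \<Rightarrow> 'k"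
    and I :: "'i set" and V :: "'i \<Rightarrow> 'h set" and v :: "'i \<Rightarrow> real"
    and J :: "'i \<Rightarrow> 'j set" and \<phi> :: "'i \<Rightarrow> 'j \<Rightarrow> 'h"
  assumes "hilbert_space smul ip"
    and "separable_space (euclidean :: 'h topology)"
    and "fusion_frame_system smul ip I V v J \<phi>"
  shows "dom (frame_operator smul ip (Sigma I J) (global_frame v \<phi>)) = UNIV \<and>
    ((\<forall>i\<in>I. parseval_frame ip (V i) (J i) (\<phi> i)) \<longrightarrow>
       frame_operator smul ip (Sigma I J) (global_frame v \<phi>) = fusion_operator ip I V v) \<and>
    (\<forall>A. (\<forall>i\<in>I. tight_frame ip (V i) (J i) (\<phi> i) A) \<longrightarrow>
       frame_operator smul ip (Sigma I J) (global_frame v \<phi>) =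
         scale_operator A (fusion_operator ip I V v)) \<and>
    (\<forall>A. (\<forall>i\<in>I. tight_frame ip (V i) (J i) (\<phi> i) (A i)) \<longrightarrow>
       frame_operator smul ip (Sigma I J) (global_frame v \<phi>) =
         fusion_operator ip I V (\<lambda>i. sqrt (A i) * v i))"
proof -
  interpret hilbert_space smul ip by fact
  note sys = assms(3)
  \<comment> \<open>The tight case for a constant family of bounds; any index in \<open>I\<close>
    supplies \<open>0 < A\<close>.\<close>
  have const: "frame_operator smul ip (Sigma I J) (global_frame v \<phi>)
      = scale_operator A (fusion_operator ip I V v)"
    if "\<forall>i\<in>I. tight_frame ip (V i) (J i) (\<phi> i) A" for A
    using that
    by (subst global_frame_operator_tight[OF sys, of "\<lambda>_. A"])
      (auto intro!: fusion_operator_sqrt_const simp: tight_frame_def frame_bounds_def)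
  have "scale_operator 1 T = T" for T :: "'h \<rightharpoonup> 'h"
    by (simp add: scale_operator_def option.map_ident)
  with const[of 1] have "frame_operator smul ip (Sigma I J) (global_frame v \<phi>) = fusion_operator ip I V v"
    if "\<forall>i\<in>I. parseval_frame ip (V i) (J i) (\<phi> i)"
    using that by (simp add: parseval_frame_def)
  moreover have "dom (frame_operator smul ip (Sigma I J) (global_frame v \<phi>)) = UNIV"
    using global_frame_operator_summable[OF sys] by (auto simp: dom_def frame_operator_def)
  ultimately show ?thesis
    using const global_frame_operator_tight[OF sys] by blast
qed

end
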